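(* Let $(g,u)$ be an $n$-person game in normal form, where $g : X = X_1 \times \cdots \times X_n \to A$ is a game form and $u=(u_1,\ldots,u_n)$ is a preference profile. For any two terminal D-boxes $Y, Z \subseteq X$ there exists a profile of $n$ permutations $\pi = (\pi_i : X_i \to X_i \mid i \in I)$ such that $\pi(Y)=Z$ and $g(x)=g(\pi(x))$ for all $x\in Y$, where $\pi(x)=(\pi_1(x_1),\ldots,\pi_n(x_n))$ and $\pi(Y)=\pi_1(Y_1)\times\cdots\times\pi_n(Y_n)$.
   Context: Let $I=\{1,\ldots,n\}$ be the set of players; each player $i\in I$ has a finite non-empty set of strategies $X_i$, and $X = X_1\times\cdots\times X_n$ is the set of strategy profiles. A game form is a mapping $g : X \to A$, where $A=\{a_1,\ldots,a_p\}$ is a finite set of outcomes. A preference profile $u=(u_1,\ldots,u_n)$ assigns to each player $i$ a complete strict order $u_i$ over $A$; equivalently, each player $i$ has a function $u(i,\cdot): A \to \mathbb{R}$ such that $u(i,a)=u(i,a')$ implies $a=a'$ (only the order matters). Write $u(i,x)=u(i,g(x))$ for $x \in X$. The pair $(g,u)$ is a game in normal form. Box: $Y=Y_1\times\cdots\times Y_n$ is a box of $X$, written $Y\subseteq X$, if $\emptyset\ne Y_i\subseteq X_i$ for all $i\in I$. Domination modulo a box: for a box $Y\subseteq X$, a player $i$ and two strategies $x_i,x'_i\in X_i$, we write $x_i\succeq x'_i \mod Y$ if $u(i,x)\ge u(i,x')$ for every two profiles $x,x' \in X$ whose $i$-th coordinates are $x_i$ and $x'_i$ respectively and such that $x_j=x'_j\in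 Y_j$ for all $j\in I\setminus\{i\}$. D-box: starting from $X$, successively eliminate dominated strategies of (possibly different) players one by one, in some order. One step passes from a current box $W$ to the box obtained by deleting from $W_i$, for some $i\in I$, a strategy $x'_i\in W_i$ such that $x_i\succeq x'_i \mod W$ for some $x_i\in W_i$, $x_i\neq x'_i$. Any box obtained from $X$ by finitely many (possibly zero) such steps is called a D-box of $X$. A box $Y$ is domination-free if for no $i\in I$ there are two distinct strategies $x_i,x'_i\in Y_i$ with $x_i\succeq x'_i \mod Y$. A domination-free D-box is called terminal. *)

theory Defs
  imports Complex_Main "HOL-Library.FuncSet" "HOL-Combinatorics.Permutations"
begin

text \<open>
  A box $Y_1 \times \cdots \times Y_n$ is represented by the family of its factors; only the
  values at players in \<open>I\<close> matter. Its profiles are the elements of \<open>Pi\<^sub>E I Y\<close>. The strategy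
  sets of all players live in one type \<open>'s\<close>, which is no restriction since they are finite and
  need not be related to each other. A preference order is given by a real-valued function that
  is injective on the outcomes.
\<close>

definition normal_form_game ::
  "'i set \<Rightarrow> ('i \<Rightarrow> 's set) \<Rightarrow> 'a set \<Rightarrow> (('i \<Rightarrow> 's) \<Rightarrow> 'a) \<Rightarrow> ('i \<Rightarrow> 'a \<Rightarrow> real) \<Rightarrow> bool" where
  "normal_form_game I X A g u \<longleftrightarrow>
     finite I \<and> (\<forall>i\<in>I. finite (X i) \<and> X i \<noteq> {}) \<and>
     finite A \<and> g \<in> Pi\<^sub>E I X \<rightarrow> A \<and> (\<forall>i\<in>I. inj_on (u i) A)"

text \<open>
  \<open>dominates I X g u Y i a b\<close> stands for $a \succeq b \mod Y$ for player \<open>i\<close>. The strategies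
  \<open>a\<close> and \<open>b\<close> range over \<open>X i\<close>, while the opponents are confined to \<open>Y\<close>.
\<close>

definition dominates ::
  "'i set \<Rightarrow> ('i \<Rightarrow> 's set) \<Rightarrow> (('i \<Rightarrow> 's) \<Rightarrow> 'a) \<Rightarrow> ('i \<Rightarrow> 'a \<Rightarrow> real) \<Rightarrow>
   ('i \<Rightarrow> 's set) \<Rightarrow> 'i \<Rightarrow> 's \<Rightarrow> 's \<Rightarrow> bool" where
  "dominates I X g u Y i a b \<longleftrightarrow>
     (\<forall>x \<in> Pi\<^sub>E I X. \<forall>x' \<in> Pi\<^sub>E I X.
        x i = a \<and> x' i = b \<and> (\<forall>j \<in> I - {i}. x j = x' j \<and> x j \<in> Y j)
        \<longrightarrow> u i (g x) \<ge> u i (g x'))"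

inductive D_box ::
  "'i set \<Rightarrow> ('i \<Rightarrow> 's set) \<Rightarrow> (('i \<Rightarrow> 's) \<Rightarrow> 'a) \<Rightarrow> ('i \<Rightarrow> 'a \<Rightarrow> real) \<Rightarrow>
   ('i \<Rightarrow> 's set) \<Rightarrow> bool"
  for I X g u where
  start: "D_box I X g u X"
| eliminate: "\<lbrakk>D_box I X g u W; i \<in> I; a \<in> W i; b \<in> W i; a \<noteq> b; dominates I X g u W i a b\<rbrakk>
    \<Longrightarrow> D_box I X g u (W(i := W i - {b}))"

definition domination_free ::
  "'i set \<Rightarrow> ('i \<Rightarrow> 's set) \<Rightarrow> (('i \<Rightarrow> 's) \<Rightarrow> 'a) \<Rightarrow> ('i \<Rightarrow> 'a \<Rightarrow> real) \<Rightarrow>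
   ('i \<Rightarrow> 's set) \<Rightarrow> bool" where
  "domination_free I X g u Y \<longleftrightarrow>
     \<not> (\<exists>i\<in>I. \<exists>a\<in>Y i. \<exists>b\<in>Y i. a \<noteq> b \<and> dominates I X g u Y i a b)"

definition terminal_D_box ::
  "'i set \<Rightarrow> ('i \<Rightarrow> 's set) \<Rightarrow> (('i \<Rightarrow> 's) \<Rightarrow> 'a) \<Rightarrow> ('i \<Rightarrow> 'a \<Rightarrow> real) \<Rightarrow>
   ('i \<Rightarrow> 's set) \<Rightarrow> bool" where
  "terminal_D_box I X g u Y \<longleftrightarrow> D_box I X g u Y \<and> domination_free I X g u Y"

end

theory Submission
  imports Defs
begin

text \<open>
  Successive elimination is treated as a rewriting relation on boxes, and the theorem is an instance
  of Newman's argument carried out modulo isomorphism of boxes, where an isomorphism renames the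
  strategies of each player and preserves the outcomes.

  The heart is the diamond property \<open>elimination_diamond\<close>. Suppose that a box \<open>W\<close> admits two
  eliminations with different results, of \<open>b\<close> because of \<open>a\<close> and of \<open>d\<close> because of \<open>c\<close>.
  Shrinking the box of the opponents only weakens the condition for domination, so each elimination survives the other one as long as
  it still has a dominating strategy. It can lose it only if both concern the same player and
  \<open>c = b\<close>, say. But then \<open>a \<succeq> b \<succeq> d\<close>, so \<open>a\<close> can replace \<open>c\<close>, except if \<open>a = d\<close>. In this last
  case \<open>b\<close> and \<open>d\<close> dominate each other, hence they always give their owner the same utility, and
  since preferences are strict, they always give the same outcome. Here \<open>W\<close> without \<open>b\<close> and \<open>W\<close>
  without \<open>d\<close> are isomorphic (\<open>box_iso_remove_equivalent\<close>). This is the only place where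
  strictness of the preferences matters.

  Isomorphic boxes admit the same eliminations (\<open>elimination_transfer\<close>), so an induction on the
  number of strategies shows that terminal boxes reached from isomorphic boxes are isomorphic
  (\<open>terminal_unique\<close>). As the strategy sets are finite, the bijections between the factors of two
  subboxes extend to permutations.
\<close>

section \<open>Domination and isomorphism inside a box\<close>

context
  fixes I :: "'i set" and g :: "('i \<Rightarrow> 's) \<Rightarrow> 'a" and u :: "'i \<Rightarrow> 'a \<Rightarrow> real"
begin

text \<open>
  For strategies that belong to the box, domination does not depend on the surrounding \<open>X\<close>. This
  form refers to the box alone, and it varies the strategy of player \<open>i\<close> in a fixed profile,
  which makes transitivity and monotonicity immediate.
\<close>

definition dominates_in :: "('i \<Rightarrow> 's set) \<Rightarrow> 'i \<Rightarrow> 's \<Rightarrow> 's \<Rightarrow> bool" where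
  "dominates_in W i a b \<longleftrightarrow> (\<forall>x \<in> Pi\<^sub>E I W. u i (g (x(i := a))) \<ge> u i (g (x(i := b))))"

definition elimination :: "('i \<Rightarrow> 's set) \<Rightarrow> ('i \<Rightarrow> 's set) \<Rightarrow> bool" where
  "elimination W W' \<longleftrightarrow>
     (\<exists>i\<in>I. \<exists>a\<in>W i. \<exists>b\<in>W i. a \<noteq> b \<and> dominates_in W i a b \<and> W' = W(i := W i - {b}))"

definition rename :: "('i \<Rightarrow> 's \<Rightarrow> 's) \<Rightarrow> ('i \<Rightarrow> 's) \<Rightarrow> 'i \<Rightarrow> 's" where
  "rename \<pi> x = (\<lambda>i\<in>I. \<pi> i (x i))"

definition box_iso_via :: "('i \<Rightarrow> 's \<Rightarrow> 's) \<Rightarrow> ('i \<Rightarrow> 's set) \<Rightarrow> ('i \<Rightarrow> 's set) \<Rightarrow> bool" where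
  "box_iso_via \<pi> Y Z \<longleftrightarrow>
     (\<forall>i\<in>I. bij_betw (\<pi> i) (Y i) (Z i)) \<and> (\<forall>x \<in> Pi\<^sub>E I Y. g (rename \<pi> x) = g x)"

definition box_iso :: "('i \<Rightarrow> 's set) \<Rightarrow> ('i \<Rightarrow> 's set) \<Rightarrow> bool" where
  "box_iso Y Z \<longleftrightarrow> (\<exists>\<pi>. box_iso_via \<pi> Y Z)"

definition strict_preferences :: "('i \<Rightarrow> 's set) \<Rightarrow> bool" where
  "strict_preferences W \<longleftrightarrow> (\<forall>i\<in>I. inj_on (u i) (g ` Pi\<^sub>E I W))"

lemma dominates_in_trans:
  "dominates_in W i a b \<Longrightarrow> dominates_in W i b c \<Longrightarrow> dominates_in W i a c"
  unfolding dominates_in_def by (meson order_trans)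

lemma dominates_in_mono:
  assumes "dominates_in W i a b" "\<And>j. j \<in> I \<Longrightarrow> V j \<subseteq> W j"
  shows "dominates_in V i a b"
  using assms PiE_mono[of I V W] unfolding dominates_in_def by blast

lemma elimination_subset: "elimination W W' \<Longrightarrow> W' i \<subseteq> W i"
  unfolding elimination_def by (auto split: if_splits)

lemma strict_preferences_mono:
  assumes "strict_preferences W" "\<And>j. j \<in> I \<Longrightarrow> V j \<subseteq> W j"
  shows "strict_preferences V"
proof -
  have "g ` Pi\<^sub>E I V \<subseteq> g ` Pi\<^sub>E I W"
    using assms(2) by (intro image_mono PiE_mono)
  then show ?thesis
    using assms(1) unfolding strict_preferences_def by (meson inj_on_subset)
qed

lemma rename_in_box:
  assumes "box_iso_via \<pi> Y Z" "x \<in> Pi\<^sub>E I Y"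
  shows "rename \<pi> x \<in> Pi\<^sub>E I Z"
  using assms unfolding rename_def box_iso_via_def by (auto dest: bij_betwE)

lemma box_iso_refl: "box_iso Y Y"
proof -
  have "rename (\<lambda>_. id) x = x" if "x \<in> Pi\<^sub>E I Y" for x
    using that by (auto simp: rename_def fun_eq_iff PiE_def extensional_def)
  then have "box_iso_via (\<lambda>_. id) Y Y"
    by (simp add: box_iso_via_def)
  then show ?thesis
    unfolding box_iso_def by blast
qed

lemma box_iso_trans:
  assumes "box_iso V Y" "box_iso Y Z"
  shows "box_iso V Z"
proof -
  obtain \<pi> \<rho> where \<pi>: "box_iso_via \<pi> V Y" and \<rho>: "box_iso_via \<rho> Y Z"
    using assms unfolding box_iso_def by blast
  have "g (rename (\<lambda>i. \<rho> i \<circ> \<pi> i) x) = g x" if x: "x \<in> Pi\<^sub>E I V" for x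
  proof -
    have "rename (\<lambda>i. \<rho> i \<circ> \<pi> i) x = rename \<rho> (rename \<pi> x)"
      by (auto simp: rename_def)
    then show ?thesis
      using \<pi> \<rho> x rename_in_box[OF \<pi> x] by (simp add: box_iso_via_def)
  qed
  then have "box_iso_via (\<lambda>i. \<rho> i \<circ> \<pi> i) V Z"
    using \<pi> \<rho> by (auto simp: box_iso_via_def intro: bij_betw_trans)
  then show ?thesis
    unfolding box_iso_def by blast
qed

lemma box_iso_sym:
  assumes "box_iso Y Z"
  shows "box_iso Z Y"
proof -
  obtain \<pi> where \<pi>: "box_iso_via \<pi> Y Z"
    using assms unfolding box_iso_def by blast
  define \<rho> where "\<rho> i = inv_into (Y i) (\<pi> i)" for i
  have bij: "bij_betw (\<rho> i) (Z i) (Y i)" if "i \<in> I" for i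
    using \<pi> that by (simp add: \<rho>_def box_iso_via_def bij_betw_inv_into)
  have "g (rename \<rho> z) = g z" if z: "z \<in> Pi\<^sub>E I Z" for z
  proof -
    have "rename \<rho> z \<in> Pi\<^sub>E I Y"
      using bij z by (auto simp: rename_def dest: bij_betwE)
    moreover have "rename \<pi> (rename \<rho> z) = z"
    proof
      fix i
      show "rename \<pi> (rename \<rho> z) i = z i"
      proof (cases "i \<in> I")
        case True
        then have "\<pi> i (\<rho> i (z i)) = z i"
          using \<pi> z unfolding \<rho>_def box_iso_via_def
          by (auto intro: bij_betw_inv_into_right)
        then show ?thesis
          using True by (simp add: rename_def)
      next
        case False
        then show ?thesis
          using z by (auto simp: rename_def PiE_def extensional_def)
      qed
    qed
    ultimately show ?thesis
      using \<pi> by (metis box_iso_via_def)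
  qed
  then have "box_iso_via \<rho> Z Y"
    using bij by (simp add: box_iso_via_def)
  then show ?thesis
    unfolding box_iso_def by blast
qed

section \<open>The diamond property up to isomorphism\<close>

text \<open>
  An isomorphism pulls domination back because it commutes with changing the strategy of one
  player. Deleting corresponding strategies then leaves the same renaming an isomorphism.
\<close>

lemma elimination_transfer:
  assumes "box_iso W W'" "elimination W' V'"
  obtains V where "elimination W V" "box_iso V V'"
proof -
  obtain \<pi> where \<pi>: "box_iso_via \<pi> W W'"
    using assms(1) unfolding box_iso_def by blast
  obtain i a' b' where i: "i \<in> I" and a': "a' \<in> W' i" and b': "b' \<in> W' i" and "a' \<noteq> b'"
    and dom': "dominates_in W' i a' b'" and V': "V' = W'(i := W' i - {b'})"
    using assms(2) unfolding elimination_def by blast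
  have bij: "bij_betw (\<pi> j) (W j) (W' j)" if "j \<in> I" for j
    using \<pi> that by (simp add: box_iso_via_def)
  obtain a b where a: "a \<in> W i" "\<pi> i a = a'" and b: "b \<in> W i" "\<pi> i b = b'"
    using bij[OF i] a' b' unfolding bij_betw_def by (metis imageE)
  have outcome: "g (x(i := s)) = g ((rename \<pi> x)(i := \<pi> i s))"
    if x: "x \<in> Pi\<^sub>E I W" and s: "s \<in> W i" for x s
  proof -
    have "x(i := s) \<in> Pi\<^sub>E I W"
      using x s i by (auto simp: PiE_iff extensional_def)
    then have "g (rename \<pi> (x(i := s))) = g (x(i := s))"
      using \<pi> by (simp add: box_iso_via_def)
    moreover have "rename \<pi> (x(i := s)) = (rename \<pi> x)(i := \<pi> i s)"
      using i by (auto simp: rename_def)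
    ultimately show ?thesis
      by simp
  qed
  have "dominates_in W i a b"
    using dom' rename_in_box[OF \<pi>] outcome a b unfolding dominates_in_def by metis
  moreover have "a \<noteq> b"
    using a b \<open>a' \<noteq> b'\<close> by blast
  ultimately have elim: "elimination W (W(i := W i - {b}))"
    using i a b unfolding elimination_def by blast
  have "bij_betw (\<pi> i) (W i - {b}) (W' i - {b'})"
    using bij_betw_DiffI[OF bij[OF i], of "{b}" "{b'}"] b b' by (simp add: bij_betw_def)
  then have "bij_betw (\<pi> j) ((W(i := W i - {b})) j) (V' j)" if "j \<in> I" for j
    using bij that by (simp add: V')
  moreover have "Pi\<^sub>E I (W(i := W i - {b})) \<subseteq> Pi\<^sub>E I W"
    by (intro PiE_mono) auto
  ultimately have "box_iso_via \<pi> (W(i := W i - {b})) V'"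
    using \<pi> by (auto simp: box_iso_via_def)
  then show thesis
    using that elim unfolding box_iso_def by blast
qed

text \<open>
  Mutually dominating strategies yield equal utilities, hence by strictness equal outcomes, so
  exchanging one for the other changes nothing.
\<close>

lemma box_iso_remove_equivalent:
  assumes strict: "strict_preferences W" and i: "i \<in> I" and b: "b \<in> W i" and d: "d \<in> W i"
    and bd: "dominates_in W i b d" and db: "dominates_in W i d b"
  shows "box_iso (W(i := W i - {b})) (W(i := W i - {d}))"
proof -
  define \<pi> where "\<pi> = (\<lambda>_. id)(i := transpose b d)"
  have "transpose b d ` (W i - {b}) = W i - {d}"
    using b d by (auto simp: image_iff transpose_def)
  then have "bij_betw (transpose b d) (W i - {b}) (W i - {d})"
    by (simp add: bij_betw_def inj_on_transpose)
  moreover have "g (rename \<pi> x) = g x" if x: "x \<in> Pi\<^sub>E I (W(i := W i - {b}))" for x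
  proof -
    have xW: "x \<in> Pi\<^sub>E I W"
      by (rule subsetD[OF PiE_mono x]) auto
    have "x i \<noteq> b"
      using PiE_mem[OF x i] by auto
    show ?thesis
    proof (cases "x i = d")
      case True
      have eq: "rename \<pi> x = x(i := b)"
        using xW True by (auto simp: rename_def \<pi>_def PiE_iff extensional_def fun_eq_iff i)
      have "x(i := b) \<in> Pi\<^sub>E I W"
        using xW b i by (auto simp: PiE_iff extensional_def)
      moreover have "u i (g (x(i := b))) = u i (g x)"
        using bd db xW True fun_upd_triv[of x i] unfolding dominates_in_def
        by (metis order_antisym)
      ultimately show ?thesis
        using strict i xW unfolding strict_preferences_def eq by (meson imageI inj_onD)
    next
      case False
      have "rename \<pi> x = x"
        using xW False \<open>x i \<noteq> b\<close>
        by (auto simp: rename_def \<pi>_def PiE_iff extensional_def fun_eq_iff)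
      then show ?thesis
        by simp
    qed
  qed
  ultimately have "box_iso_via \<pi> (W(i := W i - {b})) (W(i := W i - {d}))"
    by (auto simp: box_iso_via_def \<pi>_def)
  then show ?thesis
    unfolding box_iso_def by blast
qed

text \<open>
  For a single player, the elimination of \<open>d\<close> can lose its dominating strategy \<open>c\<close> only if
  \<open>c = b\<close>; by transitivity \<open>a\<close> then takes over, unless \<open>a = d\<close>.
\<close>

lemma elimination_survives:
  assumes i: "i \<in> I" and "a \<in> W i" "c \<in> W i" "d \<in> W i" "a \<noteq> b" "c \<noteq> d" "b \<noteq> d"
    and ab: "dominates_in W i a b" and cd: "dominates_in W i c d"
    and not_equivalent: "\<not> (a = d \<and> c = b)"
  shows "elimination (W(i := W i - {b})) (W(i := W i - {b} - {d}))"
proof -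
  \<comment> \<open>The witness is \<open>c\<close>, or \<open>a\<close> if \<open>c = b\<close>.\<close>
  obtain e where e: "e \<in> W i" "e \<noteq> b" "e \<noteq> d" "dominates_in W i e d"
    using assms dominates_in_trans[OF ab] by metis
  then have "dominates_in (W(i := W i - {b})) i e d"
    by (auto elim!: dominates_in_mono split: if_splits)
  then show ?thesis
    unfolding elimination_def using e assms
    by (intro bexI[of _ i] bexI[of _ e] bexI[of _ d]) auto
qed

lemma elimination_diamond:
  assumes strict: "strict_preferences W" and "elimination W W1" "elimination W W2"
  shows "box_iso W1 W2 \<or> (\<exists>V. elimination W1 V \<and> elimination W2 V)"
proof -
  obtain i a b where i: "i \<in> I" and a: "a \<in> W i" and b: "b \<in> W i" and "a \<noteq> b"
    and ab: "dominates_in W i a b" and W1: "W1 = W(i := W i - {b})"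
    using assms(2) unfolding elimination_def by blast
  obtain j c d where j: "j \<in> I" and c: "c \<in> W j" and d: "d \<in> W j" and "c \<noteq> d"
    and cd: "dominates_in W j c d" and W2: "W2 = W(j := W j - {d})"
    using assms(3) unfolding elimination_def by blast
  consider "i \<noteq> j" | "i = j" "b = d" | "i = j" "a = d" "c = b"
    | "i = j" "b \<noteq> d" "\<not> (a = d \<and> c = b)"
    by blast
  then show ?thesis
  proof cases
    case 1
    define V where "V = W(i := W i - {b}, j := W j - {d})"
    have "dominates_in W1 j c d"
      using cd by (rule dominates_in_mono) (auto simp: W1)
    then have "elimination W1 V"
      unfolding elimination_def using 1 j c d \<open>c \<noteq> d\<close>
      by (intro bexI[of _ j] bexI[of _ c] bexI[of _ d]) (auto simp: W1 V_def)
    moreover have "dominates_in W2 i a b"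
      using ab by (rule dominates_in_mono) (auto simp: W2)
    then have "elimination W2 V"
      unfolding elimination_def using 1 i a b \<open>a \<noteq> b\<close>
      by (intro bexI[of _ i] bexI[of _ a] bexI[of _ b]) (auto simp: W2 V_def fun_upd_twist)
    ultimately show ?thesis
      by blast
  next
    case 2
    then show ?thesis
      using box_iso_refl by (simp add: W1 W2)
  next
    case 3
    then show ?thesis
      using box_iso_remove_equivalent[OF strict i b, of d] ab cd d by (simp add: W1 W2)
  next
    case 4
    have "elimination W1 (W(i := W i - {b} - {d}))"
      unfolding W1 using 4 i a c d \<open>a \<noteq> b\<close> \<open>c \<noteq> d\<close> ab cd
      by (intro elimination_survives[of i a W c d b]) auto
    moreover have "elimination W2 (W(i := W i - {d} - {b}))"
      unfolding W2 \<open>i = j\<close>[symmetric] using 4 i a b c \<open>a \<noteq> b\<close> \<open>c \<noteq> d\<close> ab cd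
      by (intro elimination_survives[of i c W a b d]) auto
    moreover have "W i - {d} - {b} = W i - {b} - {d}"
      by blast
    ultimately show ?thesis
      by metis
  qed
qed

section \<open>Uniqueness of terminal boxes\<close>

definition box_size :: "('i \<Rightarrow> 's set) \<Rightarrow> nat" where
  "box_size W = (\<Sum>i\<in>I. card (W i))"

lemma elimination_box_size:
  assumes "finite I" "\<And>i. i \<in> I \<Longrightarrow> finite (W i)" "elimination W W'"
  shows "box_size W' < box_size W"
proof -
  obtain i b where i: "i \<in> I" and b: "b \<in> W i" and W': "W' = W(i := W i - {b})"
    using assms(3) unfolding elimination_def by blast
  show ?thesis
    unfolding box_size_def
  proof (rule sum_strict_mono_ex1)
    show "\<forall>j\<in>I. card (W' j) \<le> card (W j)"
      using assms elimination_subset by (simp add: card_mono)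
    have "card (W' i) < card (W i)"
      using assms(2)[OF i] b unfolding W' by (simp only: fun_upd_same card_Diff1_less)
    then show "\<exists>j\<in>I. card (W' j) < card (W j)"
      using i by blast
  qed fact
qed

lemma terminal_exists:
  assumes "finite I" "\<And>i. i \<in> I \<Longrightarrow> finite (W i)"
  shows "\<exists>T. elimination\<^sup>*\<^sup>* W T \<and> (\<nexists>V. elimination T V)"
  using assms(2)
proof (induction "box_size W" arbitrary: W rule: less_induct)
  case less
  show ?case
  proof (cases "\<exists>V. elimination W V")
    case True
    then obtain V where V: "elimination W V"
      by blast
    have "finite (V i)" if "i \<in> I" for i
      using less.prems[OF that] elimination_subset[OF V] by (rule rev_finite_subset)
    then obtain T where "elimination\<^sup>*\<^sup>* V T" "\<nexists>V. elimination T V"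
      using less.hyps[OF elimination_box_size[OF assms(1) less.prems V]] by blast
    then show ?thesis
      using V by (meson converse_rtranclp_into_rtranclp)
  qed blast
qed

text \<open>
  The induction needs two isomorphic starting boxes rather than one: after the first steps on both
  sides, the diamond property gives boxes that agree only up to isomorphism.
\<close>

lemma terminal_unique:
  assumes "finite I" "\<And>i. i \<in> I \<Longrightarrow> finite (W i)" "strict_preferences W" "box_iso W W'"
    and "elimination\<^sup>*\<^sup>* W Y" "\<nexists>V. elimination Y V"
    and "elimination\<^sup>*\<^sup>* W' Z" "\<nexists>V. elimination Z V"
  shows "box_iso Y Z"
  using assms(2-)
proof (induction "box_size W" arbitrary: W W' Y Z rule: less_induct)
  case less
  have fin: "finite (V i)" if "elimination W V" "i \<in> I" for V i
    using less.prems(1)[OF that(2)] elimination_subset[OF that(1)] by (rule rev_finite_subset)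
  have strict: "strict_preferences V" if "elimination W V" for V
    using less.prems(2) elimination_subset[OF that] by (rule strict_preferences_mono)
  have IH: "box_iso S T" if "elimination W V" "box_iso V V'" "elimination\<^sup>*\<^sup>* V S" "\<nexists>V. elimination S V"
    "elimination\<^sup>*\<^sup>* V' T" "\<nexists>V. elimination T V" for V V' S T
    using less.hyps[OF elimination_box_size[OF assms(1) less.prems(1) that(1)]]
      fin[OF that(1)] strict[OF that(1)] that(2-) by blast
  show ?case
  proof (cases "\<exists>V. elimination W V")
    case False
    then have "W = Y"
      using less.prems(4) by (auto elim: converse_rtranclpE)
    moreover have "\<nexists>V'. elimination W' V'"
      using False elimination_transfer[OF less.prems(3)] by blast
    then have "W' = Z"
      using less.prems(6) by (auto elim: converse_rtranclpE)
    ultimately show ?thesis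
      using less.prems(3) by simp
  next
    case True
    then have "\<exists>V'. elimination W' V'"
      using elimination_transfer[OF box_iso_sym[OF less.prems(3)]] by blast
    then obtain W1' where W1': "elimination W' W1'" "elimination\<^sup>*\<^sup>* W1' Z"
      using less.prems(6,7) by (metis converse_rtranclpE)
    obtain W1 where W1: "elimination W W1" "elimination\<^sup>*\<^sup>* W1 Y"
      using True less.prems(4,5) by (metis converse_rtranclpE)
    obtain W2 where W2: "elimination W W2" "box_iso W2 W1'"
      using elimination_transfer[OF less.prems(3) W1'(1)] by blast
    from elimination_diamond[OF less.prems(2) W1(1) W2(1)] show ?thesis
    proof (elim disjE exE conjE)
      assume "box_iso W1 W2"
      then have "box_iso W1 W1'"
        using W2(2) by (rule box_iso_trans)
      then show ?thesis
        using IH[OF W1(1) _ W1(2) _ W1'(2)] less.prems by blast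
    next
      fix V assume V: "elimination W1 V" "elimination W2 V"
      have "finite (V i)" if "i \<in> I" for i
        using fin[OF W1(1) that] elimination_subset[OF V(1)] by (rule rev_finite_subset)
      then obtain T where T: "elimination\<^sup>*\<^sup>* V T" "\<nexists>V. elimination T V"
        using terminal_exists[OF assms(1)] by blast
      have "box_iso Y T"
        using IH[OF W1(1) box_iso_refl W1(2)] less.prems(5) T V(1)
        by (meson converse_rtranclp_into_rtranclp)
      moreover have "box_iso T Z"
        using IH[OF W2(1,2)] less.prems(7) T V(2) W1'(2)
        by (meson converse_rtranclp_into_rtranclp)
      ultimately show ?thesis
        by (rule box_iso_trans)
    qed
  qed
qed

section \<open>D-boxes as iterated eliminations\<close>

lemma dominates_iff_dominates_in:
  assumes "\<And>j. j \<in> I \<Longrightarrow> W j \<subseteq> X j" "i \<in> I" "a \<in> W i" "b \<in> W i"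
  shows "dominates I X g u W i a b \<longleftrightarrow> dominates_in W i a b"
proof
  assume dom: "dominates I X g u W i a b"
  show "dominates_in W i a b"
    unfolding dominates_in_def
  proof
    fix x assume x: "x \<in> Pi\<^sub>E I W"
    have "x(i := a) \<in> Pi\<^sub>E I X" "x(i := b) \<in> Pi\<^sub>E I X"
      using x assms by (fastforce simp: PiE_iff extensional_def)+
    then show "u i (g (x(i := b))) \<le> u i (g (x(i := a)))"
      using dom x by (auto simp: dominates_def PiE_iff)
  qed
next
  assume dom: "dominates_in W i a b"
  show "dominates I X g u W i a b"
    unfolding dominates_def
  proof (intro ballI impI, elim conjE)
    fix x x'
    assume x: "x \<in> Pi\<^sub>E I X" "x i = a" and x': "x' \<in> Pi\<^sub>E I X" "x' i = b"
      and agree: "\<forall>j\<in>I - {i}. x j = x' j \<and> x j \<in> W j"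
    have "x \<in> Pi\<^sub>E I W"
      using x agree assms(3) by (auto simp: PiE_iff)
    moreover have "x(i := a) = x"
      using x by auto
    moreover have "x(i := b) = x'"
    proof
      fix j
      show "(x(i := b)) j = x' j"
        using x x' agree by (cases "j \<in> I") (auto simp: PiE_iff extensional_def)
    qed
    ultimately show "u i (g x') \<le> u i (g x)"
      using dom unfolding dominates_in_def by metis
  qed
qed

lemma D_box_eliminations:
  assumes "D_box I X g u W"
  shows "elimination\<^sup>*\<^sup>* X W \<and> (\<forall>j. W j \<subseteq> X j)"
  using assms
proof induction
  case start
  then show ?case
    by simp
next
  case (eliminate W i a b)
  then have "dominates_in W i a b"
    using dominates_iff_dominates_in[of W X i a b] by blast
  then have "elimination W (W(i := W i - {b}))"
    using eliminate.hyps unfolding elimination_def by blast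
  then show ?case
    using eliminate.IH elimination_subset
    by (blast intro: rtranclp.rtrancl_into_rtrancl)
qed

lemma domination_free_no_elimination:
  assumes "domination_free I X g u W" "\<And>j. j \<in> I \<Longrightarrow> W j \<subseteq> X j"
  shows "\<nexists>V. elimination W V"
  using assms dominates_iff_dominates_in[of W X]
  unfolding domination_free_def elimination_def by blast

end

section \<open>From bijections to permutations\<close>

lemma bij_betw_extends_to_permutation:
  assumes "finite X" "Y \<subseteq> X" "Z \<subseteq> X" "bij_betw f Y Z"
  obtains p where "p permutes X" "\<And>x. x \<in> Y \<Longrightarrow> p x = f x"
proof -
  have "card (X - Y) = card (X - Z)"
    using assms by (metis bij_betw_same_card card_Diff_subset finite_subset)
  then obtain h where h: "bij_betw h (X - Y) (X - Z)"
    using assms(1) by (meson finite_Diff finite_same_card_bij)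
  define p where "p x = (if x \<in> Y then f x else if x \<in> X then h x else x)" for x
  have "bij_betw p Y Z"
    using assms(4) by (simp add: p_def cong: bij_betw_cong)
  moreover have "bij_betw p (X - Y) (X - Z)"
    using h by (subst bij_betw_cong[of _ _ h]) (auto simp: p_def)
  ultimately have "bij_betw p (Y \<union> (X - Y)) (Z \<union> (X - Z))"
    by (rule bij_betw_combine) blast
  then have "bij_betw p X X"
    using assms(2,3) by (simp add: Un_absorb1)
  then have "p permutes X"
    by (rule bij_imp_permutes) (use assms(2) in \<open>auto simp: p_def\<close>)
  then show thesis
    using that by (simp add: p_def)
qed

theorem theorem1:
  fixes n :: nat
    and X Y Z :: "nat \<Rightarrow> 's set"
    and A :: "'a set"
    and g :: "(nat \<Rightarrow> 's) \<Rightarrow> 'a"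
    and u :: "nat \<Rightarrow> 'a \<Rightarrow> real"
  assumes "normal_form_game {1..n} X A g u"
    and "terminal_D_box {1..n} X g u Y"
    and "terminal_D_box {1..n} X g u Z"
  shows "\<exists>\<pi> :: nat \<Rightarrow> 's \<Rightarrow> 's.
           (\<forall>i\<in>{1..n}. \<pi> i permutes X i) \<and>
           (\<Pi>\<^sub>E i\<in>{1..n}. \<pi> i ` Y i) = (\<Pi>\<^sub>E i\<in>{1..n}. Z i) \<and>
           (\<forall>x \<in> (\<Pi>\<^sub>E i\<in>{1..n}. Y i). g x = g (\<lambda>i\<in>{1..n}. \<pi> i (x i)))"
proof -
  let ?I = "{1..n}"
  have fin: "finite (X i)" if "i \<in> ?I" for i
    using assms(1) that by (simp add: normal_form_game_def)
  have "g ` Pi\<^sub>E ?I X \<subseteq> A"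
    using assms(1) by (auto simp: normal_form_game_def)
  then have strict: "strict_preferences ?I g u X"
    using assms(1) unfolding strict_preferences_def normal_form_game_def
    by (meson inj_on_subset)
  have D_boxes: "D_box ?I X g u Y" "D_box ?I X g u Z"
    and free: "domination_free ?I X g u Y" "domination_free ?I X g u Z"
    using assms(2,3) by (auto simp: terminal_D_box_def)
  note Y = D_box_eliminations[OF D_boxes(1)] and Z = D_box_eliminations[OF D_boxes(2)]
  have "box_iso ?I g Y Z"
    using terminal_unique[OF _ fin strict box_iso_refl, of Y Z] Y Z
      domination_free_no_elimination[OF free(1)] domination_free_no_elimination[OF free(2)]
    by blast
  then obtain \<rho> where bij: "\<forall>i\<in>?I. bij_betw (\<rho> i) (Y i) (Z i)"
    and outcome: "\<forall>x \<in> Pi\<^sub>E ?I Y. g (rename ?I \<rho> x) = g x"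
    unfolding box_iso_def box_iso_via_def by blast
  have "\<exists>p. p permutes X i \<and> (\<forall>x\<in>Y i. p x = \<rho> i x)" if "i \<in> ?I" for i
    using bij_betw_extends_to_permutation[OF fin[OF that], of "Y i" "Z i" "\<rho> i"] Y Z bij that
    by metis
  then obtain \<pi> where perm: "\<forall>i\<in>?I. \<pi> i permutes X i"
    and ext: "\<forall>i\<in>?I. \<forall>x\<in>Y i. \<pi> i x = \<rho> i x"
    by metis
  have "\<pi> i ` Y i = Z i" if "i \<in> ?I" for i
  proof -
    have "\<pi> i ` Y i = \<rho> i ` Y i"
      using ext that by (intro image_cong) auto
    then show ?thesis
      using bij that by (auto simp: bij_betw_def)
  qed
  then have "(\<Pi>\<^sub>E i\<in>?I. \<pi> i ` Y i) = (\<Pi>\<^sub>E i\<in>?I. Z i)"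
    by (rule PiE_cong)
  moreover have "g x = g (\<lambda>i\<in>?I. \<pi> i (x i))" if x: "x \<in> Pi\<^sub>E ?I Y" for x
  proof -
    have "(\<lambda>i\<in>?I. \<pi> i (x i)) = rename ?I \<rho> x"
      unfolding rename_def using ext x by (intro restrict_ext) (simp add: PiE_iff)
    then show ?thesis
      using outcome x by simp
  qed
  ultimately show ?thesis
    using perm by blast
qed

end
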